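(* Let $A$ be a commutative $\Bbbk$-algebra, $M$ an $A$-module and $(A,L,\omega)$ a Lie-Rinehart algebra. For every Lie-Rinehart algebra $(A,L',\omega')$ acting on $M$ via $\rho:L'\to\mathrm{End}_\Bbbk(M)$ and every morphism $f:L'\to L$ of Lie-Rinehart algebras over $A$, there exists a unique morphism $\tilde f:L'\to\mathrm{DO}(A,L,M)$ of Lie-Rinehart algebras over $A$ such that $\varrho\circ\tilde f=\rho$ and $q_2\circ\tilde f=f$, where $\varrho:\mathrm{DO}(A,L,M)\to\mathrm{End}_\Bbbk(M)$, $(g,X)\mapsto g$, and $q_2:\mathrm{DO}(A,L,M)\to L$, $(g,X)\mapsto X$.
   Context: $\Bbbk$ is a field of characteristic $0$. A Lie-Rinehart algebra $(A,L,\omega)$ over a commutative $\Bbbk$-algebra $A$ is a $\Bbbk$-Lie algebra $L$ with a left $A$-module structure and a Lie algebra morphism $\omega:L\to\mathrm{Der}_\Bbbk(A)$ (the anchor) such that $\omega(a\cdot X)=a\cdot\omega(X)$ and $[X,a\cdot Y]=a\cdot[X,Y]+\omega(X)(a)\cdot Y$ for all $a\in A$, $X,Y\in L$. A morphism over $A$ from $(L,\omega)$ to $(L',\omega')$ is an $A$-linear Lie algebra morphism $f$ with $\omega'\circ f=\omega$. "$(A,L',\omega')$ acts on $M$ via $\rho$" means that $\rho:L'\to\mathrm{End}_\Bbbk(M)$ makes the $A$-module $M$ an $(A,L',\omega')$-module: $\rho$ is a Lie algebra morphism (commutator bracket) with $\rho(a\cdot X)(m)=a\cdot\rho(X)(m)$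 and $\rho(X)(a\cdot m)=a\cdot\rho(X)(m)+\omega'(X)(a)\cdot m$ for all $X\in L'$, $m\in M$, $a\in A$. $\mathrm{DO}(A,L,M)$ is the subspace of $\mathrm{End}_\Bbbk(M)\times L$ of all $(g,X)$ such that $g(a\cdot m)=\omega(X)(a)\cdot m+a\cdot g(m)$ for all $a\in A$, $m\in M$. It is a Lie-Rinehart algebra over $A$ with component-wise bracket and $A$-action ($(a\cdot g)(m)=a\cdot g(m)$) and anchor $\tilde\omega(g,X)=\omega(X)$. *)

theory Defs
  imports "HOL-Algebra.Module"
begin

definition char_zero :: "('k, 'x) ring_scheme \<Rightarrow> bool"
  where "char_zero K \<longleftrightarrow> (\<forall>n::nat. 0 < n \<longrightarrow> [n] \<cdot>\<^bsub>K\<^esub> \<one>\<^bsub>K\<^esub> \<noteq> \<zero>\<^bsub>K\<^esub>)"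

definition mod_hom ::
    "('k, 'x) ring_scheme \<Rightarrow> ('k, 'v, 'y) module_scheme \<Rightarrow> ('k, 'w, 'z) module_scheme \<Rightarrow> ('v \<Rightarrow> 'w) set"
  where "mod_hom K V W = {f \<in> carrier V \<rightarrow> carrier W.
     (\<forall>v\<in>carrier V. \<forall>w\<in>carrier V. f (v \<oplus>\<^bsub>V\<^esub> w) = f v \<oplus>\<^bsub>W\<^esub> f w) \<and>
     (\<forall>c\<in>carrier K. \<forall>v\<in>carrier V. f (c \<odot>\<^bsub>V\<^esub> v) = c \<odot>\<^bsub>W\<^esub> f v)}"

text \<open>
  Since the record of modules extends the record of rings, it has fields \<open>monoid.mult\<close> and \<open>one\<close>;
  they carry no meaning for a module that is not an algebra, and their values are irrelevant there.
  For a \<open>K\<close>-algebra \<open>A\<close> and an \<open>A\<close>-module \<open>V\<close>, the underlying \<open>K\<close>-vector space of \<open>V\<close> has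
  scalar multiplication \<open>c v = (c 1\<^sub>A) v\<close>. All further fields, such as a bracket, are kept.
\<close>

definition restrict_scalars ::
    "('k, 'a, 'x) module_scheme \<Rightarrow> ('a, 'v, 'y) module_scheme \<Rightarrow> ('k, 'v, 'y) module_scheme"
  where "restrict_scalars A V =
    \<lparr>carrier = carrier V, monoid.mult = monoid.mult V, one = one V,
     ring.zero = ring.zero V, ring.add = ring.add V,
     smult = (\<lambda>c v. (c \<odot>\<^bsub>A\<^esub> \<one>\<^bsub>A\<^esub>) \<odot>\<^bsub>V\<^esub> v), \<dots> = module.more V\<rparr>"

record ('k, 'l) lie = "('k, 'l) module" +
  brack :: "'l \<Rightarrow> 'l \<Rightarrow> 'l"

locale lie_algebra = field K + module K L
  for K :: "('k, 'x) ring_scheme" and L :: "('k, 'l, 'y) lie_scheme" +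
  assumes brack_closed: "\<lbrakk>X \<in> carrier L; Y \<in> carrier L\<rbrakk> \<Longrightarrow> brack L X Y \<in> carrier L"
    and brack_add_left: "\<lbrakk>X \<in> carrier L; Y \<in> carrier L; Z \<in> carrier L\<rbrakk> \<Longrightarrow>
      brack L (X \<oplus>\<^bsub>L\<^esub> Y) Z = brack L X Z \<oplus>\<^bsub>L\<^esub> brack L Y Z"
    and brack_add_right: "\<lbrakk>X \<in> carrier L; Y \<in> carrier L; Z \<in> carrier L\<rbrakk> \<Longrightarrow>
      brack L X (Y \<oplus>\<^bsub>L\<^esub> Z) = brack L X Y \<oplus>\<^bsub>L\<^esub> brack L X Z"
    and brack_smult_left: "\<lbrakk>c \<in> carrier K; X \<in> carrier L; Y \<in> carrier L\<rbrakk> \<Longrightarrow>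
      brack L (c \<odot>\<^bsub>L\<^esub> X) Y = c \<odot>\<^bsub>L\<^esub> brack L X Y"
    and brack_smult_right: "\<lbrakk>c \<in> carrier K; X \<in> carrier L; Y \<in> carrier L\<rbrakk> \<Longrightarrow>
      brack L X (c \<odot>\<^bsub>L\<^esub> Y) = c \<odot>\<^bsub>L\<^esub> brack L X Y"
    and brack_self: "X \<in> carrier L \<Longrightarrow> brack L X X = \<zero>\<^bsub>L\<^esub>"
    and jacobi: "\<lbrakk>X \<in> carrier L; Y \<in> carrier L; Z \<in> carrier L\<rbrakk> \<Longrightarrow>
      brack L X (brack L Y Z) \<oplus>\<^bsub>L\<^esub> brack L Y (brack L Z X) \<oplus>\<^bsub>L\<^esub> brack L Z (brack L X Y) = \<zero>\<^bsub>L\<^esub>"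

definition lie_hom ::
    "('k, 'x) ring_scheme \<Rightarrow> ('k, 'l, 'y) lie_scheme \<Rightarrow> ('k, 'm, 'z) lie_scheme \<Rightarrow> ('l \<Rightarrow> 'm) set"
  where "lie_hom K L L' = {f \<in> mod_hom K L L'.
     \<forall>X\<in>carrier L. \<forall>Y\<in>carrier L. f (brack L X Y) = brack L' (f X) (f Y)}"

text \<open>
  The Lie algebra of endomorphisms of a \<open>K\<close>-vector space, with the commutator bracket. A map on
  the carrier is represented by its extensional version, so that equality of endomorphisms is
  equality of HOL functions.
\<close>

definition End_lie ::
    "('k, 'x) ring_scheme \<Rightarrow> ('k, 'v, 'y) module_scheme \<Rightarrow> ('k, 'v \<Rightarrow> 'v) lie"
  where "End_lie K V =
    \<lparr>carrier = mod_hom K V V \<inter> extensional (carrier V),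
     monoid.mult = compose (carrier V),
     one = (\<lambda>v\<in>carrier V. v),
     ring.zero = (\<lambda>v\<in>carrier V. \<zero>\<^bsub>V\<^esub>),
     ring.add = (\<lambda>g h. \<lambda>v\<in>carrier V. g v \<oplus>\<^bsub>V\<^esub> h v),
     smult = (\<lambda>c g. \<lambda>v\<in>carrier V. c \<odot>\<^bsub>V\<^esub> g v),
     brack = (\<lambda>g h. \<lambda>v\<in>carrier V. g (h v) \<ominus>\<^bsub>V\<^esub> h (g v))\<rparr>"

definition Der_lie ::
    "('k, 'x) ring_scheme \<Rightarrow> ('k, 'a, 'y) module_scheme \<Rightarrow> ('k, 'a \<Rightarrow> 'a) lie"
  where "Der_lie K A = (End_lie K A)\<lparr>carrier := {D \<in> carrier (End_lie K A).
     \<forall>a\<in>carrier A. \<forall>b\<in>carrier A. D (a \<otimes>\<^bsub>A\<^esub> b) = a \<otimes>\<^bsub>A\<^esub> D b \<oplus>\<^bsub>A\<^esub> D a \<otimes>\<^bsub>A\<^esub> b}\<rparr>"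

locale lie_rinehart = algebra K A + lie_module: module A L
  for K :: "('k, 'x) ring_scheme" and A :: "('k, 'a, 'y) module_scheme"
    and L :: "('a, 'l, 'z) lie_scheme" +
  fixes \<omega> :: "'l \<Rightarrow> 'a \<Rightarrow> 'a"
  assumes lie_algebra: "lie_algebra K (restrict_scalars A L)"
    and anchor_lie_hom: "\<omega> \<in> lie_hom K (restrict_scalars A L) (Der_lie K A)"
    and anchor_smult: "\<lbrakk>a \<in> carrier A; X \<in> carrier L; b \<in> carrier A\<rbrakk> \<Longrightarrow>
      \<omega> (a \<odot>\<^bsub>L\<^esub> X) b = a \<otimes>\<^bsub>A\<^esub> \<omega> X b"
    and brack_leibniz: "\<lbrakk>a \<in> carrier A; X \<in> carrier L; Y \<in> carrier L\<rbrakk> \<Longrightarrow>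
      brack L X (a \<odot>\<^bsub>L\<^esub> Y) = a \<odot>\<^bsub>L\<^esub> brack L X Y \<oplus>\<^bsub>L\<^esub> \<omega> X a \<odot>\<^bsub>L\<^esub> Y"

locale lie_rinehart_hom = source: lie_rinehart K A L \<omega> + target: lie_rinehart K A L' \<omega>'
  for K :: "('k, 'x) ring_scheme" and A :: "('k, 'a, 'y) module_scheme"
    and L :: "('a, 'l, 'z) lie_scheme" and \<omega> :: "'l \<Rightarrow> 'a \<Rightarrow> 'a"
    and L' :: "('a, 'm, 'w) lie_scheme" and \<omega>' :: "'m \<Rightarrow> 'a \<Rightarrow> 'a" +
  fixes f :: "'l \<Rightarrow> 'm"
  assumes linear: "f \<in> mod_hom A L L'"
    and lie_hom: "f \<in> lie_hom K (restrict_scalars A L) (restrict_scalars A L')"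
    and anchor: "X \<in> carrier L \<Longrightarrow> \<omega>' (f X) = \<omega> X"

text \<open>\<open>(A, L, \<omega>)\<close> acts on the \<open>A\<close>-module \<open>M\<close> via \<open>\<rho>\<close>.\<close>

locale lie_rinehart_action = lie_rinehart K A L \<omega> + acted: module A M
  for K :: "('k, 'x) ring_scheme" and A :: "('k, 'a, 'y) module_scheme"
    and L :: "('a, 'l, 'z) lie_scheme" and \<omega> :: "'l \<Rightarrow> 'a \<Rightarrow> 'a"
    and M :: "('a, 'm, 'w) module_scheme" +
  fixes \<rho> :: "'l \<Rightarrow> 'm \<Rightarrow> 'm"
  assumes action_lie_hom:
      "\<rho> \<in> lie_hom K (restrict_scalars A L) (End_lie K (restrict_scalars A M))"
    and action_smult: "\<lbrakk>a \<in> carrier A; X \<in> carrier L; m \<in> carrier M\<rbrakk> \<Longrightarrow>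
      \<rho> (a \<odot>\<^bsub>L\<^esub> X) m = a \<odot>\<^bsub>M\<^esub> \<rho> X m"
    and action_leibniz: "\<lbrakk>a \<in> carrier A; X \<in> carrier L; m \<in> carrier M\<rbrakk> \<Longrightarrow>
      \<rho> X (a \<odot>\<^bsub>M\<^esub> m) = a \<odot>\<^bsub>M\<^esub> \<rho> X m \<oplus>\<^bsub>M\<^esub> \<omega> X a \<odot>\<^bsub>M\<^esub> m"

definition DO ::
    "('k, 'x) ring_scheme \<Rightarrow> ('k, 'a, 'y) module_scheme \<Rightarrow> ('a, 'l, 'z) lie_scheme \<Rightarrow>
     ('l \<Rightarrow> 'a \<Rightarrow> 'a) \<Rightarrow> ('a, 'm, 'w) module_scheme \<Rightarrow> ('a, ('m \<Rightarrow> 'm) \<times> 'l) lie"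
  where "DO K A L \<omega> M = (let E = End_lie K (restrict_scalars A M) in
    \<lparr>carrier = {(g, X). g \<in> carrier E \<and> X \<in> carrier L \<and>
       (\<forall>a\<in>carrier A. \<forall>m\<in>carrier M. g (a \<odot>\<^bsub>M\<^esub> m) = \<omega> X a \<odot>\<^bsub>M\<^esub> m \<oplus>\<^bsub>M\<^esub> a \<odot>\<^bsub>M\<^esub> g m)},
     monoid.mult = undefined,
     one = undefined,
     ring.zero = (\<zero>\<^bsub>E\<^esub>, \<zero>\<^bsub>L\<^esub>),
     ring.add = (\<lambda>(g, X) (h, Y). (g \<oplus>\<^bsub>E\<^esub> h, X \<oplus>\<^bsub>L\<^esub> Y)),
     smult = (\<lambda>a (g, X). (\<lambda>m\<in>carrier M. a \<odot>\<^bsub>M\<^esub> g m, a \<odot>\<^bsub>L\<^esub> X)),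
     brack = (\<lambda>(g, X) (h, Y). (brack E g h, brack L X Y))\<rparr>)"

definition DO_anchor :: "('l \<Rightarrow> 'a \<Rightarrow> 'a) \<Rightarrow> ('m \<Rightarrow> 'm) \<times> 'l \<Rightarrow> 'a \<Rightarrow> 'a"
  where "DO_anchor \<omega> = (\<lambda>(g, X). \<omega> X)"

end

theory Submission
  imports Defs
begin

text \<open>
  Both projections are jointly injective on \<open>DO(A, L, M)\<close>, so \<open>X \<mapsto> (\<rho> X, f X)\<close> is the only candidate.
  It takes values in \<open>DO(A, L, M)\<close> because \<open>\<omega> \<circ> f = \<omega>'\<close> turns the Leibniz rule of the action \<open>\<rho>\<close>
  into the condition defining \<open>DO\<close>, and it is a morphism because \<open>\<rho>\<close> and \<open>f\<close> are.
  That \<open>DO(A, L, M)\<close> is a Lie-Rinehart algebra, which a morphism into it presupposes, is checked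
  componentwise: its bracket is that of \<open>End(M) \<times> L\<close>, and \<open>\<omega>\<close> being a Lie morphism gives closure.
\<close>

section \<open>Differences in abelian groups and modules\<close>

context abelian_group
begin

lemma add_diff:
  "\<lbrakk>x \<in> carrier G; y \<in> carrier G; z \<in> carrier G\<rbrakk> \<Longrightarrow> x \<oplus> (y \<ominus> z) = (x \<oplus> y) \<ominus> z"
  by (simp add: a_minus_def a_assoc)

lemma diff_add:
  "\<lbrakk>x \<in> carrier G; y \<in> carrier G; z \<in> carrier G\<rbrakk> \<Longrightarrow> (x \<ominus> y) \<oplus> z = (x \<oplus> z) \<ominus> y"
  by (simp add: a_minus_def a_ac)

lemma diff_diff_left:
  "\<lbrakk>x \<in> carrier G; y \<in> carrier G; z \<in> carrier G\<rbrakk> \<Longrightarrow> (x \<ominus> y) \<ominus> z = x \<ominus> (y \<oplus> z)"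
  by (simp add: a_minus_def minus_add a_ac)

lemma diff_diff_right:
  "\<lbrakk>x \<in> carrier G; y \<in> carrier G; z \<in> carrier G\<rbrakk> \<Longrightarrow> x \<ominus> (y \<ominus> z) = (x \<oplus> z) \<ominus> y"
  by (simp add: a_minus_def minus_add a_ac)

lemma diff_eq_iff:
  assumes "x \<in> carrier G" "y \<in> carrier G" "z \<in> carrier G"
  shows "x \<ominus> y = z \<longleftrightarrow> x = z \<oplus> y"
  using assms by (metis a_minus_def a_inv_closed add.inv_solve_right')

lemma eq_diff_iff:
  assumes "x \<in> carrier G" "y \<in> carrier G" "z \<in> carrier G"
  shows "z = x \<ominus> y \<longleftrightarrow> z \<oplus> y = x"
  using diff_eq_iff [OF assms] by metis

text \<open>As rewrite rules, these pull differences out of sums, merge nested differences and carry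
  the subtrahend across the equation. Only sums remain, so \<open>a_ac\<close> can settle identities
  between commutators.\<close>

lemmas diff_simps = add_diff diff_add diff_diff_left diff_diff_right diff_eq_iff eq_diff_iff

end

lemma (in module) smult_r_diff:
  "\<lbrakk>a \<in> carrier R; x \<in> carrier M; y \<in> carrier M\<rbrakk> \<Longrightarrow> a \<odot>\<^bsub>M\<^esub> (x \<ominus>\<^bsub>M\<^esub> y) = a \<odot>\<^bsub>M\<^esub> x \<ominus>\<^bsub>M\<^esub> a \<odot>\<^bsub>M\<^esub> y"
  by (simp add: a_minus_def smult_r_distr smult_r_minus)

lemma (in module) smult_l_diff:
  "\<lbrakk>a \<in> carrier R; b \<in> carrier R; x \<in> carrier M\<rbrakk> \<Longrightarrow> (a \<ominus>\<^bsub>R\<^esub> b) \<odot>\<^bsub>M\<^esub> x = a \<odot>\<^bsub>M\<^esub> x \<ominus>\<^bsub>M\<^esub> b \<odot>\<^bsub>M\<^esub> x"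
  by (simp add: a_minus_def smult_l_distr smult_l_minus)

text \<open>Commutativity of the ring of scalars enters here. It is what makes a scalar multiple of
  a linear map linear again.\<close>

lemma (in module) smult_lcomm:
  "\<lbrakk>a \<in> carrier R; b \<in> carrier R; x \<in> carrier M\<rbrakk> \<Longrightarrow> a \<odot>\<^bsub>M\<^esub> (b \<odot>\<^bsub>M\<^esub> x) = b \<odot>\<^bsub>M\<^esub> (a \<odot>\<^bsub>M\<^esub> x)"
  by (metis R.m_comm smult_assoc1)

text \<open>Provides the additive inverses in \<open>End_lie\<close> and \<open>DO\<close>: they are
  multiples by -1, whose membership is a case of closure under scalars.\<close>

lemma (in module) minus_one_smult_add:
  "x \<in> carrier M \<Longrightarrow> (\<ominus>\<^bsub>R\<^esub> \<one>\<^bsub>R\<^esub>) \<odot>\<^bsub>M\<^esub> x \<oplus>\<^bsub>M\<^esub> x = \<zero>\<^bsub>M\<^esub>"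
  by (simp add: smult_l_minus M.l_neg)

section \<open>Restriction of scalars\<close>

lemma restrict_scalars_simps [simp]:
  "carrier (restrict_scalars A V) = carrier V"
  "\<zero>\<^bsub>restrict_scalars A V\<^esub> = \<zero>\<^bsub>V\<^esub>"
  "v \<oplus>\<^bsub>restrict_scalars A V\<^esub> w = v \<oplus>\<^bsub>V\<^esub> w"
  "c \<odot>\<^bsub>restrict_scalars A V\<^esub> v = (c \<odot>\<^bsub>A\<^esub> \<one>\<^bsub>A\<^esub>) \<odot>\<^bsub>V\<^esub> v"
  "\<ominus>\<^bsub>restrict_scalars A V\<^esub> v = \<ominus>\<^bsub>V\<^esub> v"
  "v \<ominus>\<^bsub>restrict_scalars A V\<^esub> w = v \<ominus>\<^bsub>V\<^esub> w"
  by (simp_all add: restrict_scalars_def a_minus_def a_inv_def m_inv_def)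

lemma brack_restrict_scalars [simp]: "brack (restrict_scalars A L) = brack L"
  by (cases L rule: lie.cases_scheme) (simp add: restrict_scalars_def)

text \<open>The map sending c to c 1 is a ring morphism from \<open>K\<close> to \<open>A\<close>,
  and the new scalar multiplication is the old one pulled back along it.\<close>

lemma module_restrict_scalars:
  assumes "algebra K A" and "module A V"
  shows "module K (restrict_scalars A V)"
proof -
  interpret A: algebra K A by fact
  interpret V: module A V by fact
  have one: "c \<odot>\<^bsub>A\<^esub> \<one>\<^bsub>A\<^esub> \<in> carrier A" if "c \<in> carrier K" for c
    using that by simp
  show ?thesis
  proof (rule moduleI)
    show "cring K" by (rule A.R_cring)
    show "abelian_group (restrict_scalars A V)"
      by (rule abelian_groupI)
        (auto simp: V.M.a_ac intro: V.M.add.l_inv_ex)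
    fix c d v assume *: "c \<in> carrier K" "d \<in> carrier K" "v \<in> carrier (restrict_scalars A V)"
    have "(c \<otimes>\<^bsub>K\<^esub> d) \<odot>\<^bsub>A\<^esub> \<one>\<^bsub>A\<^esub> = (c \<odot>\<^bsub>A\<^esub> \<one>\<^bsub>A\<^esub>) \<otimes>\<^bsub>A\<^esub> (d \<odot>\<^bsub>A\<^esub> \<one>\<^bsub>A\<^esub>)"
      using * by (simp add: A.smult_assoc1 A.smult_assoc2)
    then show "(c \<otimes>\<^bsub>K\<^esub> d) \<odot>\<^bsub>restrict_scalars A V\<^esub> v
        = c \<odot>\<^bsub>restrict_scalars A V\<^esub> (d \<odot>\<^bsub>restrict_scalars A V\<^esub> v)"
      using * by (simp add: one V.smult_assoc1)
  qed (auto simp: one A.smult_l_distr V.smult_l_distr V.smult_r_distr)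
qed

lemma mod_hom_restrict_scalars:
  assumes "algebra K A" and "f \<in> mod_hom A V W"
  shows "f \<in> mod_hom K (restrict_scalars A V) (restrict_scalars A W)"
proof -
  interpret algebra K A by fact
  show ?thesis
    using assms(2) by (simp add: mod_hom_def)
qed

section \<open>The Lie algebra of endomorphisms\<close>

lemma End_lie_apply [simp]:
  assumes "v \<in> carrier V"
  shows "\<zero>\<^bsub>End_lie K V\<^esub> v = \<zero>\<^bsub>V\<^esub>"
    and "(g \<oplus>\<^bsub>End_lie K V\<^esub> h) v = g v \<oplus>\<^bsub>V\<^esub> h v"
    and "(c \<odot>\<^bsub>End_lie K V\<^esub> g) v = c \<odot>\<^bsub>V\<^esub> g v"
    and "brack (End_lie K V) g h v = g (h v) \<ominus>\<^bsub>V\<^esub> h (g v)"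
  using assms by (simp_all add: End_lie_def)

text \<open>No condition on \<open>g\<close> and \<open>h\<close> is needed, since every operation
  restricts its result to the carrier. Equations between such results may therefore be checked
  pointwise.\<close>

lemma End_lie_extensional [simp]:
  "\<zero>\<^bsub>End_lie K V\<^esub> \<in> extensional (carrier V)"
  "g \<oplus>\<^bsub>End_lie K V\<^esub> h \<in> extensional (carrier V)"
  "c \<odot>\<^bsub>End_lie K V\<^esub> g \<in> extensional (carrier V)"
  "brack (End_lie K V) g h \<in> extensional (carrier V)"
  by (simp_all add: End_lie_def)

lemma End_lie_carrier_iff:
  "g \<in> carrier (End_lie K V) \<longleftrightarrow> g \<in> mod_hom K V V \<and> g \<in> extensional (carrier V)"
  by (simp add: End_lie_def)

lemma End_lieD:
  assumes "g \<in> carrier (End_lie K V)"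
  shows "v \<in> carrier V \<Longrightarrow> g v \<in> carrier V"
    and "v \<in> carrier V \<Longrightarrow> w \<in> carrier V \<Longrightarrow> g (v \<oplus>\<^bsub>V\<^esub> w) = g v \<oplus>\<^bsub>V\<^esub> g w"
    and "c \<in> carrier K \<Longrightarrow> v \<in> carrier V \<Longrightarrow> g (c \<odot>\<^bsub>V\<^esub> v) = c \<odot>\<^bsub>V\<^esub> g v"
    and "g \<in> extensional (carrier V)"
  using assms by (auto simp: End_lie_carrier_iff mod_hom_def)

lemma End_lieI:
  assumes "\<And>v. v \<in> carrier V \<Longrightarrow> g v \<in> carrier V"
    and "\<And>v w. v \<in> carrier V \<Longrightarrow> w \<in> carrier V \<Longrightarrow> g (v \<oplus>\<^bsub>V\<^esub> w) = g v \<oplus>\<^bsub>V\<^esub> g w"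
    and "\<And>c v. c \<in> carrier K \<Longrightarrow> v \<in> carrier V \<Longrightarrow> g (c \<odot>\<^bsub>V\<^esub> v) = c \<odot>\<^bsub>V\<^esub> g v"
    and "g \<in> extensional (carrier V)"
  shows "g \<in> carrier (End_lie K V)"
  using assms by (auto simp: End_lie_carrier_iff mod_hom_def)

text \<open>Apply additivity of \<open>g\<close> to v = (v - w) + w and solve for the value at v -
  w. Composites with commutators are expanded this way.\<close>

lemma (in module) End_lie_diff:
  assumes g: "g \<in> carrier (End_lie R M)" and v: "v \<in> carrier M" and w: "w \<in> carrier M"
  shows "g (v \<ominus>\<^bsub>M\<^esub> w) = g v \<ominus>\<^bsub>M\<^esub> g w"
proof -
  have "(v \<ominus>\<^bsub>M\<^esub> w) \<oplus>\<^bsub>M\<^esub> w = v"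
    using v w by (metis M.diff_eq_iff M.minus_closed)
  then have "g (v \<ominus>\<^bsub>M\<^esub> w) \<oplus>\<^bsub>M\<^esub> g w = g v"
    using End_lieD(2) [OF g M.minus_closed [OF v w] w] by simp
  then show ?thesis
    using v w by (simp add: M.eq_diff_iff End_lieD [OF g])
qed

lemma (in module) End_lie_closed:
  assumes g: "g \<in> carrier (End_lie R M)" and h: "h \<in> carrier (End_lie R M)"
  shows "g \<oplus>\<^bsub>End_lie R M\<^esub> h \<in> carrier (End_lie R M)"
    and "c \<in> carrier R \<Longrightarrow> c \<odot>\<^bsub>End_lie R M\<^esub> g \<in> carrier (End_lie R M)"
    and "brack (End_lie R M) g h \<in> carrier (End_lie R M)"
  by (rule End_lieI; simp add: End_lieD [OF g] End_lieD [OF h] M.a_ac smult_r_distr smult_lcomm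
      smult_r_diff M.diff_simps)+

lemma (in module) End_lie_lie_algebra:
  assumes "field R"
  shows "lie_algebra R (End_lie R M)"
proof -
  let ?E = "End_lie R M"
  have zero: "\<zero>\<^bsub>?E\<^esub> \<in> carrier ?E"
    by (rule End_lieI) simp_all
  have ext: "g = h"
    if "g \<in> extensional (carrier M)" "h \<in> extensional (carrier M)" "\<And>v. v \<in> carrier M \<Longrightarrow> g v = h v"
    for g h :: "'c \<Rightarrow> 'c"
    using that by (rule extensionalityI)
  note [simp] = End_lie_closed End_lieD End_lie_diff zero
  have "abelian_group ?E"
  proof (rule abelian_groupI)
    fix g assume g: "g \<in> carrier ?E"
    show "\<exists>h\<in>carrier ?E. h \<oplus>\<^bsub>?E\<^esub> g = \<zero>\<^bsub>?E\<^esub>"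
    proof
      \<comment> \<open>The inverse of \<open>g\<close> is (-1) g.\<close>
      show "(\<ominus>\<^bsub>R\<^esub> \<one>\<^bsub>R\<^esub>) \<odot>\<^bsub>?E\<^esub> g \<in> carrier ?E"
        using g by simp
      show "(\<ominus>\<^bsub>R\<^esub> \<one>\<^bsub>R\<^esub>) \<odot>\<^bsub>?E\<^esub> g \<oplus>\<^bsub>?E\<^esub> g = \<zero>\<^bsub>?E\<^esub>"
        using g by (intro ext) (simp_all add: minus_one_smult_add)
    qed
  qed (auto simp: M.a_ac intro!: ext)
  then have "module R ?E"
    by (intro moduleI)
      (auto simp: smult_l_distr smult_r_distr smult_assoc1 R.cring_axioms intro!: ext)
  moreover have "lie_algebra_axioms R ?E"
    \<comment> \<open>The optional \<open>ext\<close> skips the closure goal, which is not an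
      equation. In the Jacobi identity, evaluation at a vector gives twelve threefold composites,
      which cancel in pairs once \<open>diff_simps\<close> has moved the negative ones to the other
      side.\<close>
    by (rule lie_algebra_axioms.intro; (intro ext)?;
        simp add: M.diff_simps M.a_ac smult_r_diff smult_r_distr)
  ultimately show ?thesis
    using assms by (intro lie_algebra.intro)
qed

section \<open>The Lie-Rinehart algebra of differential operators\<close>

context lie_rinehart
begin

lemma field_K: "field K"
  using lie_algebra by (rule lie_algebra.axioms)

lemma anchor_Der: "X \<in> carrier L \<Longrightarrow> \<omega> X \<in> carrier (Der_lie K A)"
  using anchor_lie_hom by (auto simp: lie_hom_def mod_hom_def)

lemma anchor_closed [simp]:
  "\<lbrakk>X \<in> carrier L; a \<in> carrier A\<rbrakk> \<Longrightarrow> \<omega> X a \<in> carrier A"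
  using anchor_Der by (auto simp: Der_lie_def dest: End_lieD(1))

lemma anchor_add:
  "\<lbrakk>X \<in> carrier L; Y \<in> carrier L; a \<in> carrier A\<rbrakk> \<Longrightarrow> \<omega> (X \<oplus>\<^bsub>L\<^esub> Y) a = \<omega> X a \<oplus>\<^bsub>A\<^esub> \<omega> Y a"
  using anchor_lie_hom by (auto simp: lie_hom_def mod_hom_def Der_lie_def)

lemma anchor_brack:
  "\<lbrakk>X \<in> carrier L; Y \<in> carrier L; a \<in> carrier A\<rbrakk> \<Longrightarrow>
    \<omega> (brack L X Y) a = \<omega> X (\<omega> Y a) \<ominus>\<^bsub>A\<^esub> \<omega> Y (\<omega> X a)"
  using anchor_lie_hom by (auto simp: lie_hom_def mod_hom_def Der_lie_def)

end

text \<open>The data on which DO(A, L, M) depends. \<open>L\<close> itself does not have to act on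
  \<open>M\<close>; in the theorem the acting algebra is the source of the morphism.\<close>

locale lie_rinehart_module = lie_rinehart K A L \<omega> + acted: module A M
  for K :: "('k, 'x) ring_scheme" and A :: "('k, 'a, 'y) module_scheme"
    and L :: "('a, 'l, 'z) lie_scheme" and \<omega> :: "'l \<Rightarrow> 'a \<Rightarrow> 'a"
    and M :: "('a, 'm, 'w) module_scheme"
begin

abbreviation E :: "('k, 'm \<Rightarrow> 'm) lie"
  where "E \<equiv> End_lie K (restrict_scalars A M)"

abbreviation D :: "('a, ('m \<Rightarrow> 'm) \<times> 'l) lie"
  where "D \<equiv> DO K A L \<omega> M"

lemma module_RM: "module K (restrict_scalars A M)"
  by (rule module_restrict_scalars [OF algebra_axioms acted.module_axioms])

lemma lie_algebra_E: "lie_algebra K E"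
  using module_RM field_K by (rule module.End_lie_lie_algebra)

lemma carrier_D_iff:
  "(g, X) \<in> carrier D \<longleftrightarrow> g \<in> carrier E \<and> X \<in> carrier L \<and>
    (\<forall>a\<in>carrier A. \<forall>m\<in>carrier M. g (a \<odot>\<^bsub>M\<^esub> m) = \<omega> X a \<odot>\<^bsub>M\<^esub> m \<oplus>\<^bsub>M\<^esub> a \<odot>\<^bsub>M\<^esub> g m)"
  by (simp add: DO_def Let_def)

lemma D_simps:
  "\<zero>\<^bsub>D\<^esub> = (\<zero>\<^bsub>E\<^esub>, \<zero>\<^bsub>L\<^esub>)"
  "(g, X) \<oplus>\<^bsub>D\<^esub> (h, Y) = (g \<oplus>\<^bsub>E\<^esub> h, X \<oplus>\<^bsub>L\<^esub> Y)"
  "a \<odot>\<^bsub>D\<^esub> (g, X) = (\<lambda>m\<in>carrier M. a \<odot>\<^bsub>M\<^esub> g m, a \<odot>\<^bsub>L\<^esub> X)"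
  "brack D (g, X) (h, Y) = (brack E g h, brack L X Y)"
  by (simp_all add: DO_def Let_def)

text \<open>For scalars from \<open>K\<close>, the pointwise A-multiple in the first component is
  the scalar multiplication of \<open>E\<close>. This lets K-bilinearity of the bracket be inherited
  from \<open>E\<close> and \<open>L\<close>.\<close>

lemma smult_D_eq_smult_E:
  "(c \<odot>\<^bsub>A\<^esub> \<one>\<^bsub>A\<^esub>) \<odot>\<^bsub>D\<^esub> (g, X) = (c \<odot>\<^bsub>E\<^esub> g, (c \<odot>\<^bsub>A\<^esub> \<one>\<^bsub>A\<^esub>) \<odot>\<^bsub>L\<^esub> X)"
  by (simp add: D_simps End_lie_def)

lemma E_ext:
  assumes "g \<in> extensional (carrier M)" "h \<in> extensional (carrier M)"
    and "\<And>m. m \<in> carrier M \<Longrightarrow> g m = h m"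
  shows "g = h"
  using assms by (rule extensionalityI)

text \<open>Stated over \<open>carrier M\<close>, the form to which simp reduces
  \<open>carrier (restrict_scalars A M)\<close>.\<close>

lemma E_extensional [simp]:
  "\<zero>\<^bsub>E\<^esub> \<in> extensional (carrier M)"
  "g \<oplus>\<^bsub>E\<^esub> h \<in> extensional (carrier M)"
  "brack E g h \<in> extensional (carrier M)"
  using End_lie_extensional [where V = "restrict_scalars A M" and K = K] by simp_all

lemma E_apply [simp]:
  assumes "m \<in> carrier M"
  shows "\<zero>\<^bsub>E\<^esub> m = \<zero>\<^bsub>M\<^esub>"
    and "(g \<oplus>\<^bsub>E\<^esub> h) m = g m \<oplus>\<^bsub>M\<^esub> h m"
    and "brack E g h m = g (h m) \<ominus>\<^bsub>M\<^esub> h (g m)"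
  using End_lie_apply [where V = "restrict_scalars A M" and K = K] assms by simp_all

lemma E_D:
  assumes "g \<in> carrier E"
  shows "m \<in> carrier M \<Longrightarrow> g m \<in> carrier M"
    and "m \<in> carrier M \<Longrightarrow> n \<in> carrier M \<Longrightarrow> g (m \<oplus>\<^bsub>M\<^esub> n) = g m \<oplus>\<^bsub>M\<^esub> g n"
    and "m \<in> carrier M \<Longrightarrow> n \<in> carrier M \<Longrightarrow> g (m \<ominus>\<^bsub>M\<^esub> n) = g m \<ominus>\<^bsub>M\<^esub> g n"
    and "c \<in> carrier K \<Longrightarrow> m \<in> carrier M \<Longrightarrow>
      g ((c \<odot>\<^bsub>A\<^esub> \<one>\<^bsub>A\<^esub>) \<odot>\<^bsub>M\<^esub> m) = (c \<odot>\<^bsub>A\<^esub> \<one>\<^bsub>A\<^esub>) \<odot>\<^bsub>M\<^esub> g m"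
    and "g \<in> extensional (carrier M)"
  using End_lieD [OF assms] module.End_lie_diff [OF module_RM assms] by simp_all

text \<open>\<open>E\<close> carries scalars from \<open>K\<close> only, so multiples by elements of
  \<open>A\<close> need their own argument: c 1 commutes with \<open>a\<close> because
  \<open>A\<close> is commutative.\<close>

lemma smult_E_closed:
  assumes a: "a \<in> carrier A" and g: "g \<in> carrier E"
  shows "(\<lambda>m\<in>carrier M. a \<odot>\<^bsub>M\<^esub> g m) \<in> carrier E"
  using a by (intro End_lieI) (simp_all add: E_D [OF g] acted.smult_r_distr acted.smult_lcomm)

lemma zero_D_closed: "\<zero>\<^bsub>D\<^esub> \<in> carrier D"
proof -
  interpret E: lie_algebra K E by (rule lie_algebra_E)
  \<comment> \<open>The zero of \<open>L\<close> is 0 times itself, and \<open>anchor_smult\<close>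
    takes the scalar 0 out.\<close>
  have "\<omega> \<zero>\<^bsub>L\<^esub> a = \<zero>\<^bsub>A\<^esub>" if "a \<in> carrier A" for a
    using that anchor_smult [of "\<zero>\<^bsub>A\<^esub>" "\<zero>\<^bsub>L\<^esub>" a] by simp
  then show ?thesis
    by (simp add: D_simps carrier_D_iff)
qed

lemma D_closed:
  assumes "P \<in> carrier D" and "Q \<in> carrier D"
  shows add_D_closed: "P \<oplus>\<^bsub>D\<^esub> Q \<in> carrier D"
    and smult_D_closed: "a \<in> carrier A \<Longrightarrow> a \<odot>\<^bsub>D\<^esub> P \<in> carrier D"
    and brack_D_closed: "brack D P Q \<in> carrier D"
proof -
  interpret E: lie_algebra K E by (rule lie_algebra_E)
  interpret RL: lie_algebra K "restrict_scalars A L" by (rule lie_algebra)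
  obtain g X h Y where [simp]: "P = (g, X)" "Q = (h, Y)"
    by (metis surj_pair)
  from assms have g: "g \<in> carrier E" and X: "X \<in> carrier L"
    and h: "h \<in> carrier E" and Y: "Y \<in> carrier L"
    and gX: "\<And>a m. \<lbrakk>a \<in> carrier A; m \<in> carrier M\<rbrakk> \<Longrightarrow>
      g (a \<odot>\<^bsub>M\<^esub> m) = \<omega> X a \<odot>\<^bsub>M\<^esub> m \<oplus>\<^bsub>M\<^esub> a \<odot>\<^bsub>M\<^esub> g m"
    and hY: "\<And>a m. \<lbrakk>a \<in> carrier A; m \<in> carrier M\<rbrakk> \<Longrightarrow>
      h (a \<odot>\<^bsub>M\<^esub> m) = \<omega> Y a \<odot>\<^bsub>M\<^esub> m \<oplus>\<^bsub>M\<^esub> a \<odot>\<^bsub>M\<^esub> h m"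
    by (simp_all add: carrier_D_iff)
  note [simp] = E_D [OF g] E_D [OF h] gX hY g X h Y
  show "P \<oplus>\<^bsub>D\<^esub> Q \<in> carrier D"
    by (simp add: D_simps carrier_D_iff anchor_add acted.smult_l_distr acted.smult_r_distr
        acted.M.a_ac)
  show "a \<odot>\<^bsub>D\<^esub> P \<in> carrier D" if "a \<in> carrier A"
    using that smult_E_closed [OF that g]
    by (simp add: D_simps carrier_D_iff anchor_smult acted.smult_r_distr acted.smult_assoc1
        acted.smult_lcomm)
  have "brack L X Y \<in> carrier L"
    using RL.brack_closed [of X Y] by simp
  \<comment> \<open>Expanding g(h(a m)) gives \<omega>(X)(\<omega>(Y)(a)) m + \<omega>(Y)(a) g(m) +
    \<omega>(X)(a) h(m) + a g(h(m)). The two middle terms are symmetric under exchange of the pairs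
    and cancel in the commutator; the first terms combine to \<omega>([X,Y])(a) m by
    \<open>anchor_brack\<close>.\<close>
  then show "brack D P Q \<in> carrier D"
    by (simp add: D_simps carrier_D_iff E.brack_closed anchor_brack acted.smult_l_diff
        acted.smult_r_diff acted.smult_r_distr acted.M.diff_simps acted.M.a_ac)
qed

text \<open>Deliberately forgets the condition linking \<open>g\<close> and \<open>X\<close>: the
  module and Lie identities already hold in the product of \<open>E\<close> and
  \<open>L\<close>.\<close>

lemma D_cases:
  assumes "P \<in> carrier D"
  obtains g X where "P = (g, X)" "g \<in> carrier E" "X \<in> carrier L"
  using assms by (cases P) (simp add: carrier_D_iff)

section \<open>Module, Lie and Lie-Rinehart structure of DO(A, L, M)\<close>

lemma abelian_group_D: "abelian_group D"
proof (rule abelian_groupI)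
  interpret E: lie_algebra K E by (rule lie_algebra_E)
  fix P assume P: "P \<in> carrier D"
  then obtain g X where gX: "P = (g, X)" "g \<in> carrier E" "X \<in> carrier L"
    by (rule D_cases)
  show "\<zero>\<^bsub>D\<^esub> \<oplus>\<^bsub>D\<^esub> P = P"
    using gX by (simp add: D_simps)
  show "\<exists>Q\<in>carrier D. Q \<oplus>\<^bsub>D\<^esub> P = \<zero>\<^bsub>D\<^esub>"
  proof
    show "(\<ominus>\<^bsub>A\<^esub> \<one>\<^bsub>A\<^esub>) \<odot>\<^bsub>D\<^esub> P \<in> carrier D"
      using P by (simp add: smult_D_closed)
    show "(\<ominus>\<^bsub>A\<^esub> \<one>\<^bsub>A\<^esub>) \<odot>\<^bsub>D\<^esub> P \<oplus>\<^bsub>D\<^esub> P = \<zero>\<^bsub>D\<^esub>"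
      using gX by (auto simp: D_simps lie_module.minus_one_smult_add acted.minus_one_smult_add E_D
          intro!: E_ext)
  qed
next
  interpret E: lie_algebra K E by (rule lie_algebra_E)
  fix P Q R assume "P \<in> carrier D" "Q \<in> carrier D"
  then show "P \<oplus>\<^bsub>D\<^esub> Q = Q \<oplus>\<^bsub>D\<^esub> P"
    by (auto elim!: D_cases simp: D_simps E.M.a_ac lie_module.M.a_ac)
  assume "R \<in> carrier D"
  with \<open>P \<in> carrier D\<close> \<open>Q \<in> carrier D\<close>
  show "(P \<oplus>\<^bsub>D\<^esub> Q) \<oplus>\<^bsub>D\<^esub> R = P \<oplus>\<^bsub>D\<^esub> (Q \<oplus>\<^bsub>D\<^esub> R)"
    by (auto elim!: D_cases simp: D_simps E.M.a_ac lie_module.M.a_ac)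
qed (auto simp: D_closed zero_D_closed)

lemma module_D: "module A D"
proof (rule moduleI)
  interpret E: lie_algebra K E by (rule lie_algebra_E)
  fix a b P assume *: "a \<in> carrier A" "b \<in> carrier A" "P \<in> carrier D"
  from \<open>P \<in> carrier D\<close> obtain g X where P: "P = (g, X)" "g \<in> carrier E" "X \<in> carrier L"
    by (rule D_cases)
  show "(a \<oplus>\<^bsub>A\<^esub> b) \<odot>\<^bsub>D\<^esub> P = a \<odot>\<^bsub>D\<^esub> P \<oplus>\<^bsub>D\<^esub> b \<odot>\<^bsub>D\<^esub> P"
    using * P by (auto simp: D_simps E_D acted.smult_l_distr lie_module.smult_l_distr intro!: E_ext)
  show "(a \<otimes>\<^bsub>A\<^esub> b) \<odot>\<^bsub>D\<^esub> P = a \<odot>\<^bsub>D\<^esub> (b \<odot>\<^bsub>D\<^esub> P)"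
    using * P by (auto simp: D_simps E_D acted.smult_assoc1 lie_module.smult_assoc1 intro!: E_ext)
  fix Q assume "Q \<in> carrier D"
  then obtain h Y where "Q = (h, Y)" "h \<in> carrier E" "Y \<in> carrier L"
    by (rule D_cases)
  then show "a \<odot>\<^bsub>D\<^esub> (P \<oplus>\<^bsub>D\<^esub> Q) = a \<odot>\<^bsub>D\<^esub> P \<oplus>\<^bsub>D\<^esub> a \<odot>\<^bsub>D\<^esub> Q"
    using * P by (auto simp: D_simps E_D acted.smult_r_distr lie_module.smult_r_distr intro!: E_ext)
next
  fix P assume "P \<in> carrier D"
  \<comment> \<open>The first component of the left side is \<open>g\<close> restricted to
    \<open>carrier M\<close>, which is \<open>g\<close> because \<open>g\<close> is
    extensional.\<close>
  then show "\<one>\<^bsub>A\<^esub> \<odot>\<^bsub>D\<^esub> P = P"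
    by (auto elim!: D_cases simp: D_simps E_D intro!: E_ext)
qed (use M_cring in \<open>auto simp: abelian_group_D smult_D_closed\<close>)

lemma lie_algebra_D: "lie_algebra K (restrict_scalars A D)"
proof -
  note E = lie_algebra.brack_closed [OF lie_algebra_E]
    lie_algebra.brack_add_left [OF lie_algebra_E]
    lie_algebra.brack_add_right [OF lie_algebra_E]
    lie_algebra.brack_smult_left [OF lie_algebra_E]
    lie_algebra.brack_smult_right [OF lie_algebra_E]
    lie_algebra.brack_self [OF lie_algebra_E]
    lie_algebra.jacobi [OF lie_algebra_E]
  note L = lie_algebra.brack_closed [OF lie_algebra]
    lie_algebra.brack_add_left [OF lie_algebra]
    lie_algebra.brack_add_right [OF lie_algebra]
    lie_algebra.brack_smult_left [OF lie_algebra]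
    lie_algebra.brack_smult_right [OF lie_algebra]
    lie_algebra.brack_self [OF lie_algebra]
    lie_algebra.jacobi [OF lie_algebra]
  note L = L [unfolded restrict_scalars_simps brack_restrict_scalars]
  have "lie_algebra_axioms K (restrict_scalars A D)"
  proof (rule lie_algebra_axioms.intro; unfold restrict_scalars_simps brack_restrict_scalars)
    fix P assume "P \<in> carrier D"
    then obtain g X where P: "P = (g, X)" "g \<in> carrier E" "X \<in> carrier L"
      by (rule D_cases)
    then show "brack D P P = \<zero>\<^bsub>D\<^esub>"
      by (simp add: D_simps E L)
    fix Q assume "Q \<in> carrier D"
    then obtain h Y where Q: "Q = (h, Y)" "h \<in> carrier E" "Y \<in> carrier L"
      by (rule D_cases)
    show "brack D P Q \<in> carrier D"
      using \<open>P \<in> carrier D\<close> \<open>Q \<in> carrier D\<close> by (rule brack_D_closed)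
    {
      fix c assume c: "c \<in> carrier K"
      show "brack D ((c \<odot>\<^bsub>A\<^esub> \<one>\<^bsub>A\<^esub>) \<odot>\<^bsub>D\<^esub> P) Q = (c \<odot>\<^bsub>A\<^esub> \<one>\<^bsub>A\<^esub>) \<odot>\<^bsub>D\<^esub> brack D P Q"
        "brack D P ((c \<odot>\<^bsub>A\<^esub> \<one>\<^bsub>A\<^esub>) \<odot>\<^bsub>D\<^esub> Q) = (c \<odot>\<^bsub>A\<^esub> \<one>\<^bsub>A\<^esub>) \<odot>\<^bsub>D\<^esub> brack D P Q"
        \<comment> \<open>Only the bracket rule of \<open>D_simps\<close> is used: its scalar rule
          would expand the multiple into a pointwise abstraction, to which bilinearity in
          \<open>E\<close> no longer applies.\<close>
        using P Q c by (simp_all add: smult_D_eq_smult_E D_simps(4) E L)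
    }
    fix R assume "R \<in> carrier D"
    then obtain k Z where R: "R = (k, Z)" "k \<in> carrier E" "Z \<in> carrier L"
      by (rule D_cases)
    show "brack D (P \<oplus>\<^bsub>D\<^esub> Q) R = brack D P R \<oplus>\<^bsub>D\<^esub> brack D Q R"
      "brack D P (Q \<oplus>\<^bsub>D\<^esub> R) = brack D P Q \<oplus>\<^bsub>D\<^esub> brack D P R"
      "brack D P (brack D Q R) \<oplus>\<^bsub>D\<^esub> brack D Q (brack D R P) \<oplus>\<^bsub>D\<^esub> brack D R (brack D P Q) = \<zero>\<^bsub>D\<^esub>"
      using P Q R by (simp_all add: D_simps E L)
  qed
  moreover have "module K (restrict_scalars A D)"
    by (rule module_restrict_scalars [OF algebra_axioms module_D])
  ultimately show ?thesis
    using field_K by (intro lie_algebra.intro)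
qed

text \<open>The anchor is \<omega> after the second projection, so its axioms come from
  \<open>L\<close>. The Leibniz rule of the bracket is the one axiom where the condition defining
  \<open>DO\<close> is used beyond closure.\<close>

lemma lie_rinehart_D: "lie_rinehart K A D (DO_anchor \<omega>)"
proof -
  have "lie_rinehart_axioms K A D (DO_anchor \<omega>)"
  proof (rule lie_rinehart_axioms.intro)
    show "lie_algebra K (restrict_scalars A D)"
      by (rule lie_algebra_D)
    show "DO_anchor \<omega> \<in> lie_hom K (restrict_scalars A D) (Der_lie K A)"
      using anchor_lie_hom
      by (auto simp: lie_hom_def mod_hom_def DO_anchor_def D_simps elim!: D_cases)
  next
    fix a P b assume *: "a \<in> carrier A" "P \<in> carrier D" "b \<in> carrier A"
    then show "DO_anchor \<omega> (a \<odot>\<^bsub>D\<^esub> P) b = a \<otimes>\<^bsub>A\<^esub> DO_anchor \<omega> P b"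
      by (auto simp: DO_anchor_def D_simps anchor_smult elim!: D_cases)
  next
    fix a P Q assume a: "a \<in> carrier A" and P: "P \<in> carrier D" and Q: "Q \<in> carrier D"
    from P obtain g X where gX: "P = (g, X)" "g \<in> carrier E" "X \<in> carrier L"
      by (rule D_cases)
    from Q obtain h Y where hY: "Q = (h, Y)" "h \<in> carrier E" "Y \<in> carrier L"
      by (rule D_cases)
    \<comment> \<open>Taken at h(m), this turns g(a h(m)) - a h(g(m)) into a [g,h](m) +
      \<omega>(X)(a) h(m), the first component of the claim; the second is
      \<open>brack_leibniz\<close> in \<open>L\<close>.\<close>
    have "g (a \<odot>\<^bsub>M\<^esub> m) = \<omega> X a \<odot>\<^bsub>M\<^esub> m \<oplus>\<^bsub>M\<^esub> a \<odot>\<^bsub>M\<^esub> g m" if "m \<in> carrier M" for m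
      using P a that by (simp add: gX carrier_D_iff)
    then show "brack D P (a \<odot>\<^bsub>D\<^esub> Q) = a \<odot>\<^bsub>D\<^esub> brack D P Q \<oplus>\<^bsub>D\<^esub> DO_anchor \<omega> P a \<odot>\<^bsub>D\<^esub> Q"
      using a gX hY
      by (auto simp: D_simps DO_anchor_def brack_leibniz E_D acted.smult_r_diff acted.M.diff_simps
          acted.M.a_ac intro!: E_ext)
  qed
  then show ?thesis
    using module_D algebra_axioms by (intro lie_rinehart.intro)
qed

end

section \<open>Existence and uniqueness of the lift\<close>

theorem theorem4p8:
  fixes K :: "('k, 'x) ring_scheme"
    and A :: "('k, 'a, 'y) module_scheme"
    and M :: "('a, 'm, 'z) module_scheme"
    and L :: "('a, 'l, 'u) lie_scheme" and \<omega> :: "'l \<Rightarrow> 'a \<Rightarrow> 'a"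
    and L' :: "('a, 'n, 'v) lie_scheme" and \<omega>' :: "'n \<Rightarrow> 'a \<Rightarrow> 'a"
    and \<rho> :: "'n \<Rightarrow> 'm \<Rightarrow> 'm" and f :: "'n \<Rightarrow> 'l"
  assumes "field K" and "char_zero K"
    and "algebra K A"
    and "module A M"
    and "lie_rinehart K A L \<omega>"
    and "lie_rinehart K A L' \<omega>'"
    and "lie_rinehart_action K A L' \<omega>' M \<rho>"
    and "lie_rinehart_hom K A L' \<omega>' L \<omega> f"
  shows "\<exists>!F. F \<in> extensional (carrier L') \<and>
    lie_rinehart_hom K A L' \<omega>' (DO K A L \<omega> M) (DO_anchor \<omega>) F \<and>
    (\<forall>X\<in>carrier L'. fst (F X) = \<rho> X) \<and>
    (\<forall>X\<in>carrier L'. snd (F X) = f X)"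
proof -
  interpret act: lie_rinehart_action K A L' \<omega>' M \<rho> by fact
  interpret f: lie_rinehart_hom K A L' \<omega>' L \<omega> f by fact
  interpret D: lie_rinehart_module K A L \<omega> M
    using \<open>lie_rinehart K A L \<omega>\<close> \<open>module A M\<close> by (intro lie_rinehart_module.intro)
  let ?F = "\<lambda>X\<in>carrier L'. (\<rho> X, f X)"
  have \<rho>_closed: "\<rho> X \<in> carrier D.E" if "X \<in> carrier L'" for X
    using act.action_lie_hom that by (auto simp: lie_hom_def mod_hom_def)
  have \<rho>_add: "\<rho> (X \<oplus>\<^bsub>L'\<^esub> Y) = \<rho> X \<oplus>\<^bsub>D.E\<^esub> \<rho> Y"
    and \<rho>_brack: "\<rho> (brack L' X Y) = brack D.E (\<rho> X) (\<rho> Y)"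
    if "X \<in> carrier L'" "Y \<in> carrier L'" for X Y
    using act.action_lie_hom that by (auto simp: lie_hom_def mod_hom_def)
  \<comment> \<open>A-linearity of the candidate needs an equality of functions, whereas
    \<open>action_smult\<close> is pointwise; both sides are extensional.\<close>
  have \<rho>_smult: "\<rho> (a \<odot>\<^bsub>L'\<^esub> X) = (\<lambda>m\<in>carrier M. a \<odot>\<^bsub>M\<^esub> \<rho> X m)"
    if "a \<in> carrier A" "X \<in> carrier L'" for a X
    using that by (intro D.E_ext) (simp_all add: act.action_smult D.E_D(5) \<rho>_closed)
  have f_closed: "f X \<in> carrier L" if "X \<in> carrier L'" for X
    using f.linear that by (auto simp: mod_hom_def)
  \<comment> \<open>Needed to evaluate the restricted function \<open>?F\<close> at a
    bracket.\<close>
  have brack_closed: "brack L' X Y \<in> carrier L'" if "X \<in> carrier L'" "Y \<in> carrier L'" for X Y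
    using lie_algebra.brack_closed [OF act.lie_algebra, of X Y] that by simp
  have F_closed: "(\<rho> X, f X) \<in> carrier D.D" if "X \<in> carrier L'" for X
    using that
    by (simp add: D.carrier_D_iff \<rho>_closed f_closed f.anchor act.action_leibniz D.E_D
        act.acted.M.a_comm)
  have linear: "?F \<in> mod_hom A L' D.D"
    using f.linear F_closed by (auto simp: mod_hom_def D.D_simps \<rho>_add \<rho>_smult)
  have lie_hom: "?F \<in> lie_hom K (restrict_scalars A L') (restrict_scalars A D.D)"
    \<comment> \<open>K-linearity follows from A-linearity, which leaves only the bracket to
      check.\<close>
    using mod_hom_restrict_scalars [OF \<open>algebra K A\<close> linear] f.lie_hom
    by (auto simp: lie_hom_def D.D_simps(4) \<rho>_brack brack_closed)
  have anchor: "DO_anchor \<omega> (?F X) = \<omega>' X" if "X \<in> carrier L'" for X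
    using that by (simp add: DO_anchor_def f.anchor)
  have "lie_rinehart_hom K A L' \<omega>' D.D (DO_anchor \<omega>) ?F"
    using act.lie_rinehart_axioms D.lie_rinehart_D linear lie_hom anchor
    by (intro lie_rinehart_hom.intro lie_rinehart_hom_axioms.intro)
  then show ?thesis
    \<comment> \<open>A competitor agrees with \<open>?F\<close> on the carrier since both
      components are prescribed there, and outside it since both are extensional.\<close>
    by (intro ex1I [of _ ?F]) (auto intro!: extensionalityI simp: prod_eq_iff)
qed

end
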